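(* Let $K\ge 1$ and consider the planar SLAM problem with $K$ landmarks and the IEKF-SLAM algorithm, both described in the context. Define the following vectors of $\mathbb{R}^{3+2K}$ (infinitesimal rotation and translations of the global frame): $$\delta X_0^R=\begin{pmatrix}1\\0_{2,1}\\0_{2,1}\\\vdots\\0_{2,1}\end{pmatrix},\qquad \delta X_0^1=\begin{pmatrix}0\\ e_1\\ e_1\\\vdots\\ e_1\end{pmatrix},\qquad \delta X_0^2=\begin{pmatrix}0\\ e_2\\ e_2\\\vdots\\ e_2\end{pmatrix},\qquad e_1=\begin{pmatrix}1\\0\end{pmatrix},\ e_2=\begin{pmatrix}0\\1\end{pmatrix},$$ where the first entry is scalar and is followed by $K+1$ blocks of size $2$. Let $\delta X_0$ be any linear combination of $\delta X_0^R,\delta X_0^1,\delta X_0^2$. If the matrix $P_{n|n}$ output by the IEKF-SLAM algorithm remains invertible (i.e. is invertible for every $n\ge 0$), then for all $n\ge 1$ $$(\delta X_0)^T P_{n|n}^{-1}\,(\delta X_0)\ \le\ (\delta X_0)^T P_{n-1|n-1}^{-1}\,(\delta X_0).$$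
   Context: Notation: $I_m$ is the $m\times m$ identity matrix, $0_{a,b}$ the $a\times b$ zero matrix, $R(\theta)=\begin{pmatrix}\cos\theta&-\sin\theta\\ \sin\theta&\cos\theta\end{pmatrix}$, $J=\begin{pmatrix}0&-1\\1&0\end{pmatrix}$, and $B(\alpha)=\begin{pmatrix}\frac{\sin\alpha}{\alpha}&-\frac{1-\cos\alpha}{\alpha}\\ \frac{1-\cos\alpha}{\alpha}&\frac{\sin\alpha}{\alpha}\end{pmatrix}$ with $B(0)=I_2$. SLAM problem. The state is $X_n=(\theta_n,x_n,p_n^1,\dots,p_n^K)\in\mathbb{R}^{3+2K}$, with heading $\theta_n\in\mathbb{R}$, robot position $x_n\in\mathbb{R}^2$ and landmark positions $p_n^j\in\mathbb{R}^2$. The dynamics are $\theta_n=\theta_{n-1}+\omega_n+w_n^\omega$, $x_n=x_{n-1}+R(\theta_{n-1})(v_n+w_n^v)$, $p_n^j=p_{n-1}^j$ for $1\le j\le K$, with inputs $\omega_n\in\mathbb{R}$, $v_n\in\mathbb{R}^2$ and noises $w_n^\omega,w_n^v$. The observation $Y_n\in\mathbb{R}^{qK}$ stacks the vectors $\tilde h[R(\theta_n)^T(p_n^k-x_n)]+V_n^k$, $k=1,\dots,K$, where $\tilde h:\mathbb{R}^2\to\mathbb{R}^q$ ($q\in\{1,2\}$) is a given function, differentiable at the points where its Jacobian is evaluated below, and $V_n^k$ are noises. Let $Q_n\in\mathbb{R}^{(3+2K)\times(3+2K)}$ be the covariance matrix of $(w_n^\omega,w_n^v,0_{2K,1})$ and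 $R_n$ the covariance matrix of $(V_n^1,\dots,V_n^K)$; these are symmetric positive semi-definite. IEKF-SLAM algorithm. Start from an estimate $\hat X_{0|0}$ and a covariance (symmetric positive semi-definite) matrix $P_{0|0}\in\mathbb{R}^{(3+2K)\times(3+2K)}$. For $n\ge 1$: Propagation: $\hat\theta_{n|n-1}=\hat\theta_{n-1|n-1}+\omega_n$, $\hat x_{n|n-1}=\hat x_{n-1|n-1}+R(\hat\theta_{n-1|n-1})v_n$, $\hat p^j_{n|n-1}=\hat p^j_{n-1|n-1}$ for $1\le j\le K$, and $P_{n|n-1}=F_nP_{n-1|n-1}F_n^T+G_nQ_nG_n^T$. Update: $z_n=Y_n-\big(\tilde h[R(\hat\theta_{n|n-1})^T(\hat p^k_{n|n-1}-\hat x_{n|n-1})]\big)_{1\le k\le K}$, $S_n=H_nP_{n|n-1}H_n^T+R_n$ (assumed invertible, so that the algorithm is well defined), $K_n=P_{n|n-1}H_n^TS_n^{-1}$, $P_{n|n}=[I-K_nH_n]P_{n|n-1}$, and $\hat X_{n|n}=\varphi(K_nz_n,\hat X_{n|n-1})$, where $\varphi\big((\delta\theta,\delta x,\delta p^1,\dots,\delta p^K),(\hat\theta,\hat x,\hat p^1,\dots,\hat p^K)\big)=\big(\hat\theta+\delta\theta,\ R(\delta\theta)\hat x+B(\delta\theta)\delta x,\ R(\delta\theta)\hat p^1+B(\delta\theta)\delta p^1,\dots,R(\delta\theta)\hat p^K+B(\delta\theta)\delta p^K\big)$. The matrices are $F_n=I_{3+2K}$, $$G_n=\begin{pmatrix}1&0_{1,2}&0_{1,2K}\\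 -J\hat x_{n-1|n-1}&R(\hat\theta_{n-1|n-1})&0_{2,2K}\\ -J\hat p^1_{n-1|n-1}&0_{2,2}&0_{2,2K}\\ \vdots&\vdots&\vdots\\ -J\hat p^K_{n-1|n-1}&0_{2,2}&0_{2,2K}\end{pmatrix},$$ and $H_n$ is the matrix whose $k$-th block row ($1\le k\le K$) is $$\nabla\tilde h^k\cdot R(\hat\theta_{n|n-1})^T\begin{pmatrix}0_{2,1}&-I_2&0_{2,2(k-1)}&I_2&0_{2,2(K-k)}\end{pmatrix},$$ with $\nabla\tilde h^k$ the Jacobian of $\tilde h$ at $R(\hat\theta_{n|n-1})^T(\hat p^k_{n|n-1}-\hat x_{n|n-1})$. *)

theory Defs
  imports "HOL-Probability.Probability"
begin

definition rot :: "real \<Rightarrow> real^2^2" where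
  "rot \<theta> = vector [vector [cos \<theta>, - sin \<theta>], vector [sin \<theta>, cos \<theta>]]"

definition J_matrix :: "real^2^2" where
  "J_matrix = vector [vector [0, -1], vector [1, 0]]"

definition B_matrix :: "real \<Rightarrow> real^2^2" where
  "B_matrix \<alpha> = (if \<alpha> = 0 then mat 1
     else vector [vector [sin \<alpha> / \<alpha>, - ((1 - cos \<alpha>) / \<alpha>)],
                  vector [(1 - cos \<alpha>) / \<alpha>, sin \<alpha> / \<alpha>]])"

text \<open>
  The landmarks are indexed by a finite type \<open>'k\<close> (so \<open>K = CARD('k) \<ge> 1\<close>).  The \<open>3 + 2 K\<close> state
  coordinates are indexed by a sum type: \<open>Inl ()\<close> is the heading, \<open>Inr (Inl i)\<close> the \<open>i\<close>-th
  coordinate of the robot position, \<open>Inr (Inr (k, i))\<close> the \<open>i\<close>-th coordinate of landmark \<open>k\<close>.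
\<close>

type_synonym 'k slam_idx = "unit + 2 + 'k \<times> 2"

lemma card_slam_idx: "CARD('k::finite slam_idx) = 3 + 2 * CARD('k)"
  by simp

definition slam_vec ::
  "real \<Rightarrow> real^2 \<Rightarrow> ('k \<Rightarrow> real^2) \<Rightarrow> real^('k::finite slam_idx)" where
  "slam_vec \<theta> x p = (\<chi> c. case c of
       Inl _ \<Rightarrow> \<theta> | Inr (Inl i) \<Rightarrow> x $ i | Inr (Inr (k, i)) \<Rightarrow> p k $ i)"

definition heading :: "real^('k::finite slam_idx) \<Rightarrow> real" where
  "heading X = X $ Inl ()"

definition position :: "real^('k::finite slam_idx) \<Rightarrow> real^2" where
  "position X = (\<chi> i. X $ Inr (Inl i))"

definition landmark :: "real^('k::finite slam_idx) \<Rightarrow> 'k \<Rightarrow> real^2" where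
  "landmark X k = (\<chi> i. X $ Inr (Inr (k, i)))"

lemma slam_vec_blocks [simp]:
  "heading (slam_vec \<theta> x p) = \<theta>"
  "position (slam_vec \<theta> x p) = x"
  "landmark (slam_vec \<theta> x p) k = p k"
  by (simp_all add: heading_def position_def landmark_def slam_vec_def vec_eq_iff)

text \<open>For \<open>'b = real\<close> this stacks vectors, for \<open>'b = real^'n\<close> it stacks the rows of block matrices.\<close>

definition stack :: "('k \<Rightarrow> 'b^'q) \<Rightarrow> 'b^('k::finite \<times> 'q::finite)" where
  "stack f = (\<chi> r. f (fst r) $ snd r)"

definition psd_matrix :: "real^'n^'n \<Rightarrow> bool" where
  "psd_matrix A \<longleftrightarrow> transpose A = A \<and> (\<forall>x. 0 \<le> x \<bullet> (A *v x))"

text \<open>Random vectors with finite second moments, so that the covariance matrix makes sense.\<close>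

definition L2_random_vector :: "'a measure \<Rightarrow> ('a \<Rightarrow> 'b::euclidean_space) \<Rightarrow> bool" where
  "L2_random_vector M Z \<longleftrightarrow> Z \<in> borel_measurable M \<and> integrable M (\<lambda>s. (norm (Z s))\<^sup>2)"

definition covariance_matrix :: "'a measure \<Rightarrow> ('a \<Rightarrow> real^'n) \<Rightarrow> real^'n^'n" where
  "covariance_matrix M Z = (\<chi> i j.
     \<integral>s. (Z s $ i - (\<integral>t. Z t $ i \<partial>M)) * (Z s $ j - (\<integral>t. Z t $ j \<partial>M)) \<partial>M)"

definition slam_dynamics ::
  "real \<Rightarrow> real^2 \<Rightarrow> real \<Rightarrow> real^2 \<Rightarrow> real^('k::finite slam_idx) \<Rightarrow> real^('k slam_idx)" where
  "slam_dynamics \<omega> v w\<omega> wv X =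
     slam_vec (heading X + \<omega> + w\<omega>) (position X + rot (heading X) *v (v + wv)) (landmark X)"

definition relative_landmark :: "real^('k::finite slam_idx) \<Rightarrow> 'k \<Rightarrow> real^2" where
  "relative_landmark X k = transpose (rot (heading X)) *v (landmark X k - position X)"

definition slam_observation ::
  "(real^2 \<Rightarrow> real^'q) \<Rightarrow> real^('k::finite slam_idx) \<Rightarrow> real^('k \<times> 'q::finite)" where
  "slam_observation h X = stack (\<lambda>k. h (relative_landmark X k))"

definition exp_retract ::
  "real^('k::finite slam_idx) \<Rightarrow> real^('k slam_idx) \<Rightarrow> real^('k slam_idx)" where
  "exp_retract \<delta> X = slam_vec (heading X + heading \<delta>)
     (rot (heading \<delta>) *v position X + B_matrix (heading \<delta>) *v position \<delta>)
     (\<lambda>k. rot (heading \<delta>) *v landmark X k + B_matrix (heading \<delta>) *v landmark \<delta> k)"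

text \<open>Column by column: the outer \<open>case\<close> selects column \<open>c\<close> of \<open>G\<close> as a block vector.\<close>

definition G_matrix :: "real^('k::finite slam_idx) \<Rightarrow> real^('k slam_idx)^('k slam_idx)" where
  "G_matrix X = (\<chi> r c. (case c of
       Inl _ \<Rightarrow> slam_vec 1 (- (J_matrix *v position X)) (\<lambda>k. - (J_matrix *v landmark X k))
     | Inr (Inl i) \<Rightarrow> slam_vec 0 (column i (rot (heading X))) (\<lambda>_. 0)
     | Inr (Inr _) \<Rightarrow> 0) $ r)"

text \<open>The \<open>2 \<times> (3 + 2 K)\<close> matrix \<open>(0, -I, 0, \<dots>, 0, I, 0, \<dots>, 0)\<close> with \<open>I\<close> in the block of landmark \<open>k\<close>.\<close>

definition landmark_selector :: "'k::finite \<Rightarrow> real^('k slam_idx)^2" where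
  "landmark_selector k = (\<chi> i c. case c of
       Inl _ \<Rightarrow> 0
     | Inr (Inl j) \<Rightarrow> (- mat 1 :: real^2^2) $ i $ j
     | Inr (Inr (l, j)) \<Rightarrow> (if l = k then (mat 1 :: real^2^2) $ i $ j else 0))"

definition H_matrix ::
  "(real^2 \<Rightarrow> real^'q) \<Rightarrow> real^('k::finite slam_idx) \<Rightarrow> real^('k slam_idx)^('k \<times> 'q::finite)" where
  "H_matrix h X = stack (\<lambda>k.
     jacobian h (at (relative_landmark X k)) ** transpose (rot (heading X)) ** landmark_selector k)"

end

theory Submission
  imports Defs
begin

text \<open>
  A perturbation \<open>d\<close> of the global frame is unobservable for the filter, \<open>H d = 0\<close>.  Hence
  \<open>(A - K H A) (A\<inverse> d) = d\<close> for the propagated covariance \<open>A\<close> and any gain \<open>K\<close>, so the update leaves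
  the information vector of \<open>d\<close> unchanged.  The propagation \<open>A = P + G Q G\<^sup>T\<close> only increases
  the covariance, so it decreases the information \<open>d\<^sup>T P\<inverse> d\<close>.
\<close>

section \<open>Square-integrable random vectors and their covariance matrices\<close>

lemma L2_random_vector_nth:
  fixes Z :: "'a \<Rightarrow> real^'n"
  assumes "L2_random_vector M Z"
  shows "L2_random_vector M (\<lambda>t. Z t $ i)"
proof -
  have m [measurable]: "Z \<in> borel_measurable M" and int: "integrable M (\<lambda>t. (norm (Z t))\<^sup>2)"
    using assms by (auto simp: L2_random_vector_def)
  have mi: "(\<lambda>t. Z t $ i) \<in> borel_measurable M"
    using borel_measurable_continuous_on[OF _ m, of "\<lambda>x. x $ i"]
    by (simp add: continuous_intros)
  have "integrable M (\<lambda>t. (norm (Z t $ i))\<^sup>2)"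
  proof (rule Bochner_Integration.integrable_bound[OF int])
    show "(\<lambda>t. (norm (Z t $ i))\<^sup>2) \<in> borel_measurable M" using mi by simp
    show "AE t in M. norm ((norm (Z t $ i))\<^sup>2) \<le> norm ((norm (Z t))\<^sup>2)"
      using power_mono[OF component_le_norm_cart abs_ge_zero, where n = 2]
      by (intro AE_I2) simp
  qed
  with mi show ?thesis by (simp add: L2_random_vector_def)
qed

lemma L2_random_vector_zero: "L2_random_vector M (\<lambda>t. 0)"
  by (simp add: L2_random_vector_def)

lemma integrable_mult_L2:
  fixes f g :: "'a \<Rightarrow> real"
  assumes "L2_random_vector M f" "L2_random_vector M g"
  shows "integrable M (\<lambda>t. f t * g t)"
proof (rule Bochner_Integration.integrable_bound)
  show "integrable M (\<lambda>t. (f t)\<^sup>2 + (g t)\<^sup>2)"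
    using assms by (simp add: L2_random_vector_def)
  show "(\<lambda>t. f t * g t) \<in> borel_measurable M"
    using assms by (auto simp: L2_random_vector_def intro: borel_measurable_times)
  have "\<bar>a * b\<bar> \<le> a\<^sup>2 + b\<^sup>2" for a b :: real
    using sum_squares_bound[of "\<bar>a\<bar>" "\<bar>b\<bar>"] abs_ge_zero[of "a * b"]
    unfolding abs_mult power2_abs by linarith
  then show "AE t in M. norm (f t * g t) \<le> norm ((f t)\<^sup>2 + (g t)\<^sup>2)"
    by simp
qed

text \<open>Expanding the square leaves a term linear in \<open>f\<close>, which is integrable
  because the measure is finite.\<close>

lemma (in prob_space) L2_random_vector_minus_const:
  fixes f :: "'a \<Rightarrow> real"
  assumes "L2_random_vector M f"
  shows "L2_random_vector M (\<lambda>t. f t - c)"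
proof -
  have m: "f \<in> borel_measurable M" and i2: "integrable M (\<lambda>t. (f t)\<^sup>2)"
    using assms by (auto simp: L2_random_vector_def)
  then have "integrable M f"
    by (rule square_integrable_imp_integrable)
  with m i2 show ?thesis
    by (simp add: L2_random_vector_def power2_diff)
qed

text \<open>The quadratic form at \<open>x\<close> is the variance of the inner product of
  \<open>x\<close> and \<open>Z\<close>, the expectation of a square. The hypothesis is
  componentwise so that it can be checked block by block for assembled noise vectors.\<close>

lemma (in prob_space) psd_covariance_matrix:
  fixes Z :: "'a \<Rightarrow> real^'n"
  assumes "\<And>i. L2_random_vector M (\<lambda>t. Z t $ i)"
  shows "psd_matrix (covariance_matrix M Z)"
  unfolding psd_matrix_def
proof (intro conjI allI)
  show "transpose (covariance_matrix M Z) = covariance_matrix M Z"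
    by (simp add: transpose_def covariance_matrix_def vec_eq_iff mult.commute)
  fix x :: "real^'n"
  define D where "D i t = Z t $ i - (\<integral>t. Z t $ i \<partial>M)" for i t
  have int: "integrable M (\<lambda>t. D i t * D j t)" for i j
    unfolding D_def by (intro integrable_mult_L2 L2_random_vector_minus_const assms)
  have "covariance_matrix M Z $ i $ j = (\<integral>t. D i t * D j t \<partial>M)" for i j
    by (simp add: covariance_matrix_def D_def)
  then have "x \<bullet> (covariance_matrix M Z *v x)
      = (\<Sum>i\<in>UNIV. \<Sum>j\<in>UNIV. x $ i * x $ j * (\<integral>t. D i t * D j t \<partial>M))"
    by (simp add: inner_vec_def matrix_vector_mult_def sum_distrib_left mult_ac)
  also have "\<dots>
      = (\<Sum>i\<in>UNIV. \<Sum>j\<in>UNIV. \<integral>t. x $ i * x $ j * (D i t * D j t) \<partial>M)"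
    by simp
  also have "\<dots> = (\<integral>t. (\<Sum>i\<in>UNIV. \<Sum>j\<in>UNIV. x $ i * x $ j * (D i t * D j t)) \<partial>M)"
    using int by (simp add: Bochner_Integration.integral_sum)
  also have "\<dots> = (\<integral>t. (\<Sum>i\<in>UNIV. x $ i * D i t)\<^sup>2 \<partial>M)"
    by (simp add: power2_eq_square sum_product mult_ac)
  finally show "0 \<le> x \<bullet> (covariance_matrix M Z *v x)"
    by simp
qed

section \<open>Adjoints, positive semi-definite matrices and inverses\<close>

lemma inner_matrix_vector_mult_sym:
  fixes A :: "real^'n^'n"
  assumes "transpose A = A"
  shows "x \<bullet> (A *v y) = (A *v x) \<bullet> y"
  using dot_lmul_matrix[of x A y] assms by (metis transpose_matrix_vector)

lemma inner_matrix_vector_mult_transpose: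
  fixes A :: "real^'n^'m"
  shows "x \<bullet> (transpose A *v y) = (A *v x) \<bullet> y"
  using dot_lmul_matrix[of y A x] by (simp add: inner_commute)

lemma transpose_add: "transpose (A + B) = transpose A + transpose B"
  by (simp add: transpose_def vec_eq_iff)

lemma transpose_diff:
  fixes A B :: "real^'n^'m"
  shows "transpose (A - B) = transpose A - transpose B"
  by (simp add: transpose_def vec_eq_iff)

lemma matrix_diff_rdistrib:
  fixes A B :: "'a::ring_1^'n^'m"
  shows "(A - B) ** C = A ** C - B ** C"
  by (simp add: matrix_matrix_mult_def vec_eq_iff left_diff_distrib sum_subtractf)

lemma psd_matrix_add:
  assumes "psd_matrix A" "psd_matrix B"
  shows "psd_matrix (A + B)"
  using assms
  by (auto simp: psd_matrix_def transpose_add matrix_vector_mult_add_rdistrib inner_add_right)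

lemma psd_matrix_congruence:
  fixes B :: "real^'n^'m"
  assumes "psd_matrix A"
  shows "psd_matrix (B ** A ** transpose B)"
proof -
  have "x \<bullet> (B ** A ** transpose B *v x) = (transpose B *v x) \<bullet> (A *v (transpose B *v x))" for x
    using inner_matrix_vector_mult_transpose[of x "transpose B"]
    by (simp add: matrix_vector_mul_assoc[symmetric])
  with assms show ?thesis
    by (simp add: psd_matrix_def matrix_transpose_mul matrix_mul_assoc)
qed

lemma matrix_inv_inverse:
  assumes "invertible A"
  shows matrix_inv_right: "A ** matrix_inv A = mat 1"
    and matrix_inv_left: "matrix_inv A ** A = mat 1"
  using someI_ex[OF assms[unfolded invertible_def]] by (simp_all add: matrix_inv_def)

lemma matrix_inv_vector_mult_eq:
  fixes A :: "real^'n^'n"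
  assumes "invertible A" "A *v u = d"
  shows "matrix_inv A *v d = u"
  using assms by (metis matrix_inv_left matrix_vector_mul_assoc matrix_vector_mul_lid)

lemma matrix_vector_mult_inv:
  fixes A :: "real^'n^'n"
  assumes "invertible A"
  shows "A *v (matrix_inv A *v d) = d"
  using assms by (metis matrix_inv_right matrix_vector_mul_assoc matrix_vector_mul_lid)

text \<open>
  With \<open>y = S\<inverse> H A x\<close> the quadratic form of the updated covariance is the completed square
  \<open>(x - H\<^sup>T y)\<^sup>T A (x - H\<^sup>T y) + y\<^sup>T R y\<close>.
\<close>

lemma psd_matrix_kalman_update:
  fixes A :: "real^'n^'n" and H :: "real^'n^'m"
  assumes A: "psd_matrix A" and R: "psd_matrix R"
    and S: "S = H ** A ** transpose H + R" and inv: "invertible S"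
  shows "psd_matrix ((mat 1 - A ** transpose H ** matrix_inv S ** H) ** A)"
    (is "psd_matrix ?P")
proof -
  have symA: "transpose A = A" using A by (simp add: psd_matrix_def)
  have symS: "transpose S = S"
    using psd_matrix_add[OF psd_matrix_congruence[OF A, of H] R] by (simp add: S psd_matrix_def)
  have symSi: "transpose (matrix_inv S) = matrix_inv S"
  proof -
    \<comment> \<open>Transposing \<open>S ** matrix_inv S = mat 1\<close> gives a left inverse of
      the symmetric \<open>S\<close>; it must agree with the right inverse.\<close>
    have "transpose (matrix_inv S) ** S = mat 1"
      using inv symS by (metis matrix_inv_right matrix_transpose_mul transpose_mat)
    then show ?thesis
      using inv by (metis matrix_inv_right matrix_mul_assoc matrix_mul_lid matrix_mul_rid)
  qed
  have P: "?P = A - A ** transpose H ** matrix_inv S ** H ** A"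
    by (simp add: matrix_diff_rdistrib)
  have "transpose ?P = ?P"
    unfolding P by (simp add: transpose_diff matrix_transpose_mul symA symSi matrix_mul_assoc)
  moreover have "0 \<le> x \<bullet> (?P *v x)" for x
  proof -
    define y where "y = matrix_inv S *v (H *v (A *v x))"
    define u where "u = transpose H *v y"
    have Sy: "S *v y = H *v (A *v x)"
      unfolding y_def using inv by (rule matrix_vector_mult_inv)
    have Su: "S *v y = H *v (A *v u) + R *v y"
      by (simp add: S u_def matrix_vector_mult_add_rdistrib matrix_vector_mul_assoc[symmetric])
    \<comment> \<open>The cross term is y^T S y and u^T A u is y^T S y - y^T R y. Expanding the
      completed square therefore leaves x^T A x - y^T S y, which is x^T P x for the updated
      covariance P.\<close>
    have xu: "u \<bullet> (A *v x) = y \<bullet> (S *v y)"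
      unfolding Sy u_def
      by (metis inner_commute inner_matrix_vector_mult_transpose)
    have uu: "u \<bullet> (A *v u) = y \<bullet> (S *v y) - y \<bullet> (R *v y)"
    proof -
      have "u \<bullet> (A *v u) = y \<bullet> (H *v (A *v u))"
        by (metis inner_commute inner_matrix_vector_mult_transpose u_def)
      then show ?thesis unfolding Su by (simp add: inner_add_right)
    qed
    have ux: "x \<bullet> (A *v u) = u \<bullet> (A *v x)"
      using inner_matrix_vector_mult_sym[OF symA, of x u] by (simp add: inner_commute)
    have "?P *v x = A *v x - A *v u"
      unfolding P u_def y_def
      by (simp add: matrix_vector_mult_diff_rdistrib matrix_vector_mul_assoc matrix_mul_assoc)
    then have "x \<bullet> (?P *v x) = (x - u) \<bullet> (A *v (x - u)) + y \<bullet> (R *v y)"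
      using xu uu ux
      by (simp add: matrix_vector_mult_diff_distrib inner_diff_left inner_diff_right)
    then show ?thesis using A R by (simp add: psd_matrix_def)
  qed
  ultimately show ?thesis by (simp add: psd_matrix_def)
qed

section \<open>Information under propagation and update\<close>

text \<open>With u = A^-1 d and w = P^-1 d, the gap between the two sides is exactly (w - u)^T P (w
  - u) + u^T D u, a sum of two nonnegative terms.\<close>

lemma inner_matrix_inv_antimono:
  fixes A P :: "real^'n^'n"
  assumes P: "psd_matrix P" and D: "psd_matrix D" and A: "A = P + D"
    and inv: "invertible P" "invertible A"
  shows "d \<bullet> (matrix_inv A *v d) \<le> d \<bullet> (matrix_inv P *v d)"
proof -
  define u w where "u = matrix_inv A *v d" and "w = matrix_inv P *v d"
  have Au: "A *v u = d" and Pw: "P *v w = d"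
    using inv by (simp_all add: u_def w_def matrix_vector_mult_inv)
  have "0 \<le> (w - u) \<bullet> (P *v (w - u))" and "0 \<le> u \<bullet> (D *v u)"
    using P D by (auto simp: psd_matrix_def)
  moreover have "w \<bullet> (P *v u) = d \<bullet> u"
    using inner_matrix_vector_mult_sym[of P w u] P Pw by (simp add: psd_matrix_def)
  moreover have "u \<bullet> (P *v u) + u \<bullet> (D *v u) = d \<bullet> u"
    using Au A by (metis inner_add_right inner_commute matrix_vector_mult_add_rdistrib)
  ultimately have "d \<bullet> u \<le> d \<bullet> w"
    by (simp add: Pw matrix_vector_mult_diff_distrib inner_diff_left inner_diff_right inner_commute)
  then show ?thesis by (simp add: u_def w_def)
qed

text \<open>Passes invertibility from the posterior covariance to the propagated one.\<close>

lemma invertible_right_factor: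
  fixes A B :: "real^'n^'n"
  assumes "invertible (B ** A)"
  shows "invertible A"
  using assms by (simp add: invertible_det_nz det_mul)

text \<open>Both matrices send the same vector \<open>matrix_inv A *v d\<close> to \<open>d\<close>,
  so their inverses agree at \<open>d\<close>. Invertibility is assumed of the product, the
  posterior covariance; that of \<open>A\<close> follows.\<close>

lemma matrix_inv_kalman_update_unobservable:
  fixes A :: "real^'n^'n" and H :: "real^'n^'m"
  assumes inv: "invertible ((mat 1 - K ** H) ** A)" and Hd: "H *v d = 0"
  shows "matrix_inv ((mat 1 - K ** H) ** A) *v d = matrix_inv A *v d"
proof (rule matrix_inv_vector_mult_eq[OF inv])
  have "A *v (matrix_inv A *v d) = d"
    using invertible_right_factor[OF inv] by (rule matrix_vector_mult_inv)
  then have "(mat 1 - K ** H) ** A *v (matrix_inv A *v d) = (mat 1 - K ** H) *v d"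
    by (simp add: matrix_vector_mul_assoc[symmetric])
  also have "\<dots> = d"
    using Hd by (simp add: matrix_vector_mult_diff_rdistrib matrix_vector_mul_assoc[symmetric])
  finally show "(mat 1 - K ** H) ** A *v (matrix_inv A *v d) = d" .
qed

section \<open>Frame perturbations lie in the kernel of the observation matrix\<close>

lemma landmark_selector_mult:
  "landmark_selector k *v d = landmark d k - position d"
proof -
  have "(landmark_selector k *v d) $ i = (landmark d k - position d) $ i" for i
  proof -
    \<comment> \<open>The sum over state indices splits along the sum type; the heading column
      contributes zero.\<close>
    have "(landmark_selector k *v d) $ i
        = (\<Sum>j\<in>UNIV. (- mat 1 :: real^2^2) $ i $ j * d $ Inr (Inl j))
        + (\<Sum>(l, j)\<in>UNIV. (if l = k then (mat 1 :: real^2^2) $ i $ j else 0) * d $ Inr (Inr (l, j)))"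
      by (simp add: matrix_vector_mult_def landmark_selector_def UNIV_Plus_UNIV[symmetric]
          sum.Plus case_prod_unfold del: UNIV_Plus_UNIV)
    also have "(\<Sum>j\<in>UNIV. (- mat 1 :: real^2^2) $ i $ j * d $ Inr (Inl j)) 
        = (\<Sum>j\<in>UNIV. if j = i then - d $ Inr (Inl j) else 0)"
      by (intro sum.cong refl) (simp add: mat_def)
    also have "(\<Sum>(l, j)\<in>UNIV. (if l = k then (mat 1 :: real^2^2) $ i $ j else 0) * d $ Inr (Inr (l, j)))
        = (\<Sum>l\<in>UNIV. \<Sum>j\<in>UNIV. (if l = k then (mat 1 :: real^2^2) $ i $ j else 0) * d $ Inr (Inr (l, j)))"
      by (simp add: UNIV_Times_UNIV[symmetric] sum.cartesian_product del: UNIV_Times_UNIV)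
    also have "\<dots> = (\<Sum>l\<in>UNIV. if l = k then landmark d l $ i else 0)"
    proof (intro sum.cong refl)
      fix l
      have "(\<Sum>j\<in>UNIV. (mat 1 :: real^2^2) $ i $ j * d $ Inr (Inr (l, j))) = landmark d l $ i"
        using matrix_vector_mul_lid[of "landmark d l"]
        by (simp add: vec_eq_iff matrix_vector_mult_def landmark_def)
      then show "(\<Sum>j\<in>UNIV. (if l = k then (mat 1 :: real^2^2) $ i $ j else 0) * d $ Inr (Inr (l, j)))
          = (if l = k then landmark d l $ i else 0)"
        by (cases "l = k") simp_all
    qed
    finally show ?thesis by (simp add: position_def)
  qed
  then show ?thesis by (simp add: vec_eq_iff)
qed

lemma stack_mult: "stack f *v d = stack (\<lambda>k. f k *v d)"
  by (simp add: stack_def matrix_vector_mult_def vec_eq_iff)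

text \<open>Translations move robot and landmarks alike, so their difference vanishes. In the error
  coordinates of \<open>exp_retract\<close> a rotation of the frame about the origin is a pure
  heading increment, so its position blocks are zero. The three generators are thus the same at
  every estimate \<open>X\<close>, which lets one fixed \<open>d\<close> serve at all times.\<close>

lemma H_matrix_mult_frame:
  assumes "d \<in> span {slam_vec 1 0 (\<lambda>_. 0), slam_vec 0 (axis 1 1) (\<lambda>_. axis 1 1),
                      slam_vec 0 (axis 2 1) (\<lambda>_. axis 2 1)}"
  shows "H_matrix h X *v d = 0"
proof -
  let ?B = "{slam_vec 1 0 (\<lambda>_. 0), slam_vec 0 (axis 1 1) (\<lambda>_. axis 1 1),
             slam_vec 0 (axis 2 1) (\<lambda>_. axis 2 1)}"
  \<comment> \<open>The rotation and the Jacobian act after the selector, so it suffices that each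
    selector annihilates \<open>d\<close>.\<close>
  have "landmark_selector k *v d = 0" for k
  proof -
    have "?B \<subseteq> {x. landmark_selector k *v x = 0}"
      by (simp add: landmark_selector_mult)
    moreover have "subspace {x. landmark_selector k *v x = 0}"
      by (auto simp: subspace_def matrix_vector_right_distrib matrix_vector_mult_scaleR)
    ultimately show ?thesis
      using assms span_minimal by blast
  qed
  then show ?thesis
    by (simp add: H_matrix_def stack_mult matrix_vector_mul_assoc[symmetric])
      (simp add: stack_def vec_eq_iff)
qed

section \<open>Noise covariances of the SLAM problem and the information inequality\<close>

lemma (in prob_space) psd_covariance_slam_noise:
  fixes w :: "'a \<Rightarrow> real"
  assumes "L2_random_vector M w" and "L2_random_vector M w'"
  shows "psd_matrix (covariance_matrix M (\<lambda>t. slam_vec (w t) (w' t) (\<lambda>_. 0)))"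
proof (rule psd_covariance_matrix)
  fix i
  show "L2_random_vector M (\<lambda>t. slam_vec (w t) (w' t) (\<lambda>_. 0) $ i)"
    using assms L2_random_vector_nth[OF assms(2)]
    \<comment> \<open>For a heading index \<open>projr i\<close> is an unspecified value; the second
      split has meaning only for position and landmark indices.\<close>
    by (cases i; cases "projr i")
      (simp_all add: slam_vec_def L2_random_vector_zero split: sum.split prod.split)
qed

lemma (in prob_space) psd_covariance_stack:
  assumes "\<And>k. L2_random_vector M (V k)"
  shows "psd_matrix (covariance_matrix M (\<lambda>t. stack (\<lambda>k. V k t)))"
  by (rule psd_covariance_matrix) (simp add: stack_def L2_random_vector_nth assms)

theorem theorem2:
  fixes M :: "'a measure"
    and h :: "real^2 \<Rightarrow> real^'q::finite"
    and \<omega> :: "nat \<Rightarrow> real" and v :: "nat \<Rightarrow> real^2"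
    and w\<omega> :: "nat \<Rightarrow> 'a \<Rightarrow> real" and wv :: "nat \<Rightarrow> 'a \<Rightarrow> real^2"
    and V :: "nat \<Rightarrow> 'k::finite \<Rightarrow> 'a \<Rightarrow> real^'q"
    and s :: 'a
    and X :: "nat \<Rightarrow> real^('k slam_idx)"
    and Y z :: "nat \<Rightarrow> real^('k \<times> 'q)"
    and Q F G :: "nat \<Rightarrow> real^('k slam_idx)^('k slam_idx)"
    and R S :: "nat \<Rightarrow> real^('k \<times> 'q)^('k \<times> 'q)"
    and H :: "nat \<Rightarrow> real^('k slam_idx)^('k \<times> 'q)"
    and gain :: "nat \<Rightarrow> real^('k \<times> 'q)^('k slam_idx)"
    \<comment> \<open>\<open>Xprior n\<close>, \<open>Pprior n\<close> have index \<open>n|n-1\<close>; \<open>Xpost n\<close>, \<open>Ppost n\<close> have index \<open>n|n\<close>\<close>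
    and Xprior Xpost :: "nat \<Rightarrow> real^('k slam_idx)"
    and Pprior Ppost :: "nat \<Rightarrow> real^('k slam_idx)^('k slam_idx)"
    and \<delta>X0 :: "real^('k slam_idx)"
  assumes q: "CARD('q) \<in> {1, 2}"
    \<comment> \<open>noises; \<open>s\<close> is the realization along which the system and the filter run\<close>
    and "prob_space M" and "s \<in> space M"
    and "\<And>n. n \<ge> 1 \<Longrightarrow> L2_random_vector M (w\<omega> n)"
    and "\<And>n. n \<ge> 1 \<Longrightarrow> L2_random_vector M (wv n)"
    and "\<And>n k. n \<ge> 1 \<Longrightarrow> L2_random_vector M (V n k)"
    and Q: "\<And>n. n \<ge> 1 \<Longrightarrow> Q n = covariance_matrix M (\<lambda>t. slam_vec (w\<omega> n t) (wv n t) (\<lambda>_. 0))"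
    and R: "\<And>n. n \<ge> 1 \<Longrightarrow> R n = covariance_matrix M (\<lambda>t. stack (\<lambda>k. V n k t))"
    \<comment> \<open>true state and observations\<close>
    and X: "\<And>n. n \<ge> 1 \<Longrightarrow> X n = slam_dynamics (\<omega> n) (v n) (w\<omega> n s) (wv n s) (X (n - 1))"
    and Y: "\<And>n. n \<ge> 1 \<Longrightarrow> Y n = slam_observation h (X n) + stack (\<lambda>k. V n k s)"
    \<comment> \<open>IEKF: initialization\<close>
    and P0: "psd_matrix (Ppost 0)"
    \<comment> \<open>IEKF: propagation\<close>
    and F: "\<And>n. n \<ge> 1 \<Longrightarrow> F n = mat 1"
    and G: "\<And>n. n \<ge> 1 \<Longrightarrow> G n = G_matrix (Xpost (n - 1))"
    and Xprior: "\<And>n. n \<ge> 1 \<Longrightarrow> Xprior n = slam_dynamics (\<omega> n) (v n) 0 0 (Xpost (n - 1))"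
    and Pprior: "\<And>n. n \<ge> 1 \<Longrightarrow>
      Pprior n = F n ** Ppost (n - 1) ** transpose (F n) + G n ** Q n ** transpose (G n)"
    \<comment> \<open>IEKF: update\<close>
    and h: "\<And>n k. n \<ge> 1 \<Longrightarrow> h differentiable (at (relative_landmark (Xprior n) k))"
    and H: "\<And>n. n \<ge> 1 \<Longrightarrow> H n = H_matrix h (Xprior n)"
    and z: "\<And>n. n \<ge> 1 \<Longrightarrow> z n = Y n - slam_observation h (Xprior n)"
    and S: "\<And>n. n \<ge> 1 \<Longrightarrow> S n = H n ** Pprior n ** transpose (H n) + R n"
    and S_inv: "\<And>n. n \<ge> 1 \<Longrightarrow> invertible (S n)"
    and gain: "\<And>n. n \<ge> 1 \<Longrightarrow> gain n = Pprior n ** transpose (H n) ** matrix_inv (S n)"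
    and Ppost: "\<And>n. n \<ge> 1 \<Longrightarrow> Ppost n = (mat 1 - gain n ** H n) ** Pprior n"
    and Xpost: "\<And>n. n \<ge> 1 \<Longrightarrow> Xpost n = exp_retract (gain n *v z n) (Xprior n)"
    \<comment> \<open>infinitesimal rotation and translations of the global frame\<close>
    and \<delta>X0: "\<delta>X0 \<in> span {slam_vec 1 0 (\<lambda>_. 0),
                       slam_vec 0 (axis 1 1) (\<lambda>_. axis 1 1),
                       slam_vec 0 (axis 2 1) (\<lambda>_. axis 2 1)}"
    and P_inv: "\<And>n. invertible (Ppost n)"
  shows "\<forall>n\<ge>1. \<delta>X0 \<bullet> (matrix_inv (Ppost n) *v \<delta>X0)
              \<le> \<delta>X0 \<bullet> (matrix_inv (Ppost (n - 1)) *v \<delta>X0)"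
proof (intro allI impI)
  have psd_Q: "psd_matrix (Q n)" and psd_R: "psd_matrix (R n)" if "n \<ge> 1" for n
    using that assms(2,4-6) by (simp_all add: Q R prob_space.psd_covariance_slam_noise
        prob_space.psd_covariance_stack)
  \<comment> \<open>As \<open>F n\<close> is the identity, propagation does not transport the
    perturbation and only adds a positive semi-definite term.\<close>
  have prior: "Pprior n = Ppost (n - 1) + G n ** Q n ** transpose (G n)"
    and post: "Ppost n = (mat 1 - gain n ** H n) ** Pprior n" if "n \<ge> 1" for n
    using that by (simp_all add: Pprior F Ppost transpose_mat)
  \<comment> \<open>Antimonotonicity of the inverse needs the preceding posterior covariance to be
    positive semi-definite; the recursion preserves this from time 0 on.\<close>
  have psd: "psd_matrix (Ppost n)" for n
  proof (induction n)
    case 0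
    show ?case by (rule P0)
  next
    case (Suc n)
    have n: "Suc n \<ge> 1" by simp
    have "psd_matrix (Pprior (Suc n))"
      unfolding prior[OF n] using Suc psd_Q[OF n]
      by (simp add: psd_matrix_add psd_matrix_congruence)
    from psd_matrix_kalman_update[OF this psd_R[OF n] S[OF n] S_inv[OF n]]
    show ?case unfolding post[OF n] gain[OF n] .
  qed
  fix n :: nat
  assume n: "n \<ge> 1"
  have inv: "invertible ((mat 1 - gain n ** H n) ** Pprior n)"
    using P_inv[of n] by (simp add: post[OF n])
  have "H n *v \<delta>X0 = 0"
    using H_matrix_mult_frame[OF \<delta>X0] by (simp add: H[OF n])
  with inv have "matrix_inv (Ppost n) *v \<delta>X0 = matrix_inv (Pprior n) *v \<delta>X0"
    unfolding post[OF n] by (rule matrix_inv_kalman_update_unobservable)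
  then show "\<delta>X0 \<bullet> (matrix_inv (Ppost n) *v \<delta>X0)
      \<le> \<delta>X0 \<bullet> (matrix_inv (Ppost (n - 1)) *v \<delta>X0)"
    using inner_matrix_inv_antimono[OF psd psd_matrix_congruence[OF psd_Q[OF n]] prior[OF n]
        P_inv invertible_right_factor[OF inv]]
    by simp
qed

end
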